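(* Let $\{A_n\}_{n\ge 0}$ be an even sequence. Then for every odd positive integer $n$, $$\sum_{k=0}^n\binom{n/2}{k}(-1)^kA_{n-k}=0.$$
   Context: A sequence $\{a_n\}_{n\ge0}$ of real (or complex) numbers is called an even sequence if $\sum_{k=0}^n\binom nk(-1)^ka_k=a_n$ for all $n=0,1,2,\ldots$, and an odd sequence if $\sum_{k=0}^n\binom nk(-1)^ka_k=-a_n$ for all $n=0,1,2,\ldots$. For real $x$ and a nonnegative integer $k$, $\binom xk=x(x-1)\cdots(x-k+1)/k!$ (with $\binom x0=1$). *)

theory Defs
  imports Complex_Main
begin

text \<open>Complex sequences; a real sequence is the special case with values in \<^term>\<open>\<real> :: complex set\<close>.\<close>

definition even_sequence :: "(nat \<Rightarrow> complex) \<Rightarrow> bool" where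
  "even_sequence a \<longleftrightarrow> (\<forall>n. (\<Sum>k=0..n. of_nat (n choose k) * (- 1) ^ k * a k) = a n)"

end

theory Submission
  imports Defs "HOL-Computational_Algebra.Formal_Power_Series"
begin

text \<open>
  Expanding each \<open>A (n - k)\<close> by evenness and exchanging the sums turns the coefficient of
  \<open>A j\<close> into a Vandermonde convolution, which by upper negation replaces the upper index \<open>x\<close>
  by \<open>n - x\<close> at the cost of a factor \<open>(- 1) ^ n\<close>. For odd \<open>n\<close> and \<open>x = n / 2\<close> the sum
  therefore equals its own negative.
\<close>

text \<open>Upper negation absorbs the alternating sign into the second binomial. Vandermonde then
  gives upper index x - j - 1, and a second negation turns it into n - x.\<close>

lemma gbinomial_alternating_convolution:
  fixes x :: "'a :: field_char_0"
  assumes "j \<le> n"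
  shows "(\<Sum>i=0..n - j. (x gchoose i) * (- 1) ^ i * of_nat ((n - i) choose j)) =
         (of_nat n - x) gchoose (n - j)"
proof -
  \<comment> \<open>Negating the upper index n - i over the lower index n - j - i gives (n - j - i)
    - (n - i) - 1 = -j - 1. It does not depend on i, which is what Vandermonde requires.\<close>
  let ?b = "- of_nat j - 1 :: 'a"
  have choose: "of_nat ((n - i) choose j) = (- 1) ^ (n - j - i) * (?b gchoose (n - j - i))"
    if "i \<le> n - j" for i
  proof -
    have "of_nat ((n - i) choose j) = (of_nat ((n - i) choose (n - j - i)) :: 'a)"
      using that assms by (subst binomial_symmetric) (auto simp: algebra_simps)
    also have "\<dots> = of_nat (n - i) gchoose (n - j - i)"
      by (rule binomial_gbinomial)
    also have "\<dots> = (- 1) ^ (n - j - i) * (?b gchoose (n - j - i))"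
      using that assms by (subst gbinomial_negated_upper) (simp add: of_nat_diff)
    finally show ?thesis .
  qed
  have "(\<Sum>i=0..n - j. (x gchoose i) * (- 1) ^ i * of_nat ((n - i) choose j)) =
        (\<Sum>i=0..n - j. (- 1) ^ (n - j) * ((x gchoose i) * (?b gchoose (n - j - i))))"
  proof (rule sum.cong)
    fix i assume "i \<in> {0..n - j}"
    then have i: "i \<le> n - j" by simp
    then have "(- 1 :: 'a) ^ (n - j) = (- 1) ^ i * (- 1) ^ (n - j - i)"
      by (metis power_add le_add_diff_inverse)
    then show "(x gchoose i) * (- 1) ^ i * of_nat ((n - i) choose j) =
        (- 1) ^ (n - j) * ((x gchoose i) * (?b gchoose (n - j - i)))"
      by (simp add: choose[OF i])
  qed simp
  also have "\<dots> = (- 1) ^ (n - j) * ((x + ?b) gchoose (n - j))"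
    by (simp only: gbinomial_Vandermonde flip: sum_distrib_left)
  also have "\<dots> = (of_nat n - x) gchoose (n - j)"
    using assms by (subst (2) gbinomial_negated_upper) (simp add: of_nat_diff algebra_simps)
  finally show ?thesis .
qed

lemma even_sequence_gbinomial_sum:
  fixes x :: complex
  assumes "even_sequence A"
  shows "(\<Sum>k=0..n. (x gchoose k) * (- 1) ^ k * A (n - k)) =
         (- 1) ^ n * (\<Sum>k=0..n. ((of_nat n - x) gchoose k) * (- 1) ^ k * A (n - k))"
proof -
  let ?c = "\<lambda>k j. (x gchoose k) * (- 1) ^ k * of_nat ((n - k) choose j)"
  have "(\<Sum>k=0..n. (x gchoose k) * (- 1) ^ k * A (n - k)) =
        (\<Sum>k=0..n. \<Sum>j | j \<in> {0..n} \<and> j \<le> n - k. ?c k j * ((- 1) ^ j * A j))"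
  proof (rule sum.cong)
    fix k
    have "{j. j \<in> {0..n} \<and> j \<le> n - k} = {0..n - k}" by auto
    moreover have "A (n - k) = (\<Sum>j=0..n - k. of_nat ((n - k) choose j) * (- 1) ^ j * A j)"
      using assms unfolding even_sequence_def by metis
    ultimately show "(x gchoose k) * (- 1) ^ k * A (n - k) =
        (\<Sum>j | j \<in> {0..n} \<and> j \<le> n - k. ?c k j * ((- 1) ^ j * A j))"
      by (simp add: sum_distrib_left mult.assoc)
  qed simp
  also have "\<dots> = (\<Sum>j=0..n. \<Sum>k | k \<in> {0..n} \<and> j \<le> n - k. ?c k j * ((- 1) ^ j * A j))"
    by (rule sum.swap_restrict) auto
  also have "\<dots> = (\<Sum>j=0..n. ((of_nat n - x) gchoose (n - j)) * ((- 1) ^ j * A j))"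
  proof (rule sum.cong)
    fix j assume "j \<in> {0..n}"
    then have j: "j \<le> n" by simp
    then have "{k. k \<in> {0..n} \<and> j \<le> n - k} = {0..n - j}" by auto
    then show "(\<Sum>k | k \<in> {0..n} \<and> j \<le> n - k. ?c k j * ((- 1) ^ j * A j)) =
        ((of_nat n - x) gchoose (n - j)) * ((- 1) ^ j * A j)"
      using gbinomial_alternating_convolution[OF j, of x] by (simp flip: sum_distrib_right)
  qed simp
  also have "\<dots> = (\<Sum>k=0..n. ((of_nat n - x) gchoose k) * ((- 1) ^ (n - k) * A (n - k)))"
    by (subst sum.atLeastAtMost_rev) (auto intro: sum.cong)
  also have "\<dots> = (- 1) ^ n * (\<Sum>k=0..n. ((of_nat n - x) gchoose k) * (- 1) ^ k * A (n - k))"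
    unfolding sum_distrib_left
    \<comment> \<open>For k \<le> n, parity gives (-1)^(n - k) = (-1)^n (-1)^k.\<close>
    by (rule sum.cong) (auto simp: minus_one_power_iff)
  finally show ?thesis .
qed

theorem theorem2p1:
  fixes A :: "nat \<Rightarrow> complex" and n :: nat
  assumes "even_sequence A"
    and "odd n"
  shows "(\<Sum>k=0..n. complex_of_real ((real n / 2) gchoose k) * (- 1) ^ k * A (n - k)) = 0"
proof -
  \<comment> \<open>As a finite product divided by a factorial, the binomial commutes with the
    embedding of the reals.\<close>
  have coeff: "complex_of_real ((real n / 2) gchoose k) = (of_nat n / 2) gchoose k" for k
    by (simp add: gbinomial_prod_rev)
  \<comment> \<open>The point n/2 is fixed by the reflection of x to n - x, so both sums coincide
    there.\<close>
  have half: "of_nat n - of_nat n / 2 = (of_nat n / 2 :: complex)"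
    by (simp add: field_simps)
  show ?thesis
    using even_sequence_gbinomial_sum[OF assms(1), where n = n and x = "of_nat n / 2"] assms(2)
    unfolding coeff half by simp
qed

end
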